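(* Let $l_1,l_2,l_3$ be integers with $2 \leq l_1 \leq l_2 \leq l_3$ and let $G = \Theta(l_1,l_2,l_3)$. (i) If the parity of $l_1$ is different from both that of $l_2$ and that of $l_3$, then $P_{DP}(G,m) = P(G,m)$ for all $m \in \mathbb{N}$. (ii) If $l_1$ and $l_2$ have the same parity and $l_3$ has different parity from $l_1$, then for all $m \geq 2$: $$P_{DP}(G,m) = \frac{1}{m}\left[ (m-1)^{l_1+l_2+l_3} + (m-1)^{l_1} - (m-1)^{l_2+1} - (m-1)^{l_3} + (-1)^{l_3+1}(m-2) \right].$$ (iii) If $l_1$ and $l_3$ have the same parity and $l_2$ has different parity from $l_1$, then for all $m \geq 2$: $$P_{DP}(G,m) = \frac{1}{m}\left[ (m-1)^{l_1+l_2+l_3} + (m-1)^{l_1} - (m-1)^{l_3+1} - (m-1)^{l_2} + (-1)^{l_2+1}(m-2) \right].$$ (iv) If $l_1,l_2,l_3$ all have the same parity, then for all $m \geq 3$: $$P_{DP}(G,m) = \frac{1}{m}\left[ (m-1)^{l_1+l_2+l_3} - (m-1)^{l_1} - (m-1)^{l_2} - (m-1)^{l_3} + 2(-1)^{l_1+l_2+l_3} \right].$$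
   Context: All graphs are finite and simple. For $l_1,\ldots,l_k \in \mathbb{N}$, the Generalized Theta graph $\Theta(l_1,\ldots,l_k)$ consists of two end vertices joined by $k$ internally disjoint paths of lengths $l_1,\ldots,l_k$; for $k=3$ it is called a Theta graph. $P(G,m)$ denotes the chromatic polynomial (number of proper colorings of $G$ with colors from $[m]=\{1,\dots,m\}$). A cover of a graph $G$ is a pair $\mathcal{H}=(L,H)$ where $H$ is a graph and $L: V(G) \to \mathcal{P}(V(H))$ satisfies: (1) $\{L(u): u \in V(G)\}$ is a partition of $V(H)$; (2) for every $u \in V(G)$, $H[L(u)]$ is complete; (3) if $E_H(L(u),L(v))$ (the set of edges of $H$ with one end in $L(u)$ and one in $L(v)$) is nonempty, then $u=v$ or $uv \in E(G)$; (4) if $uv \in E(G)$, then $E_H(L(u),L(v))$ is a matching (possibly empty). The cover is $m$-fold if $|L(u)|=m$ for all $u$. An $\mathcal{H}$-coloring of $G$ is an independent set in $H$ of size $|V(G)|$. $P_{DP}(G,\mathcal{H})$ is the number of $\mathcal{H}$-colorings of $G$, and the DP color function $P_{DP}(G,m)$ (for $m \in \mathbb{N}$) is the minimum of $P_{DP}(G,\mathcal{H})$ over all $m$-fold covers $\mathcal{H}$ of $G$. *)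

theory Defs
  imports Complex_Main "HOL-Library.FuncSet" "HOL-Library.Disjoint_Sets"
begin

record 'a graph =
  verts :: "'a set"
  edges :: "'a set set"

definition simple_graph :: "'a graph \<Rightarrow> bool" where
  "simple_graph G \<longleftrightarrow> finite (verts G) \<and> (\<forall>e \<in> edges G. e \<subseteq> verts G \<and> card e = 2)"

datatype theta_vertex = End1 | End2 | Inner nat nat

text \<open>The \<open>j\<close>-th vertex (\<open>0 \<le> j \<le> ls ! i\<close>) on the \<open>i\<close>-th of the paths joining the two end vertices.\<close>

definition theta_path_vertex :: "nat list \<Rightarrow> nat \<Rightarrow> nat \<Rightarrow> theta_vertex" where
  "theta_path_vertex ls i j =
     (if j = 0 then End1 else if j = ls ! i then End2 else Inner i j)"

definition generalized_theta :: "nat list \<Rightarrow> theta_vertex graph" where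
  "generalized_theta ls =
     \<lparr> verts = {End1, End2} \<union> {theta_path_vertex ls i j | i j. i < length ls \<and> j \<le> ls ! i},
       edges = {{theta_path_vertex ls i j, theta_path_vertex ls i (Suc j)} | i j.
                  i < length ls \<and> j < ls ! i} \<rparr>"

definition chromatic_polynomial :: "'a graph \<Rightarrow> nat \<Rightarrow> nat" where
  "chromatic_polynomial G m =
     card {c \<in> verts G \<rightarrow>\<^sub>E {1..m}. \<forall>u v. {u, v} \<in> edges G \<longrightarrow> c u \<noteq> c v}"

definition edges_between :: "'b graph \<Rightarrow> 'b set \<Rightarrow> 'b set \<Rightarrow> 'b set set" where
  "edges_between H A B = {e \<in> edges H. \<exists>a \<in> A. \<exists>b \<in> B. e = {a, b}}"

definition is_matching :: "'b set set \<Rightarrow> bool" where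
  "is_matching M \<longleftrightarrow> pairwise disjnt M"

text \<open>Only the values of \<open>L\<close> on the vertices of \<open>G\<close> matter.\<close>

definition is_cover :: "'a graph \<Rightarrow> ('a \<Rightarrow> 'b set) \<Rightarrow> 'b graph \<Rightarrow> bool" where
  "is_cover G L H \<longleftrightarrow>
     simple_graph H \<and>
     (disjoint_family_on L (verts G) \<and> (\<Union>u \<in> verts G. L u) = verts H) \<and>
     (\<forall>u \<in> verts G. \<forall>x \<in> L u. \<forall>y \<in> L u. x \<noteq> y \<longrightarrow> {x, y} \<in> edges H) \<and>
     (\<forall>u \<in> verts G. \<forall>v \<in> verts G.
        edges_between H (L u) (L v) \<noteq> {} \<longrightarrow> u = v \<or> {u, v} \<in> edges G) \<and>
     (\<forall>u \<in> verts G. \<forall>v \<in> verts G.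
        {u, v} \<in> edges G \<longrightarrow> is_matching (edges_between H (L u) (L v)))"

definition is_fold_cover :: "nat \<Rightarrow> 'a graph \<Rightarrow> ('a \<Rightarrow> 'b set) \<Rightarrow> 'b graph \<Rightarrow> bool" where
  "is_fold_cover m G L H \<longleftrightarrow>
     is_cover G L H \<and> (\<forall>u \<in> verts G. finite (L u) \<and> card (L u) = m)"

definition independent_set :: "'b graph \<Rightarrow> 'b set \<Rightarrow> bool" where
  "independent_set H I \<longleftrightarrow> I \<subseteq> verts H \<and> (\<forall>x \<in> I. \<forall>y \<in> I. {x, y} \<notin> edges H)"

definition cover_colorings :: "'a graph \<Rightarrow> 'b graph \<Rightarrow> 'b set set" where
  "cover_colorings G H = {I. independent_set H I \<and> card I = card (verts G)}"

text \<open>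
  The minimum ranges over covers \<open>H\<close> whose vertices are natural numbers; by the lemma
  \<open>fold_cover_nat\<close> below, covers over any other vertex type give no further values.
\<close>

definition dp_color_function :: "'a graph \<Rightarrow> nat \<Rightarrow> nat" where
  "dp_color_function G m =
     (LEAST n. \<exists>L (H :: nat graph). is_fold_cover m G L H \<and> n = card (cover_colorings G H))"

lemma fold_cover_nat:
  fixes L :: "'a \<Rightarrow> 'b set" and H :: "'b graph"
  assumes "is_fold_cover m G L H"
  shows "\<exists>L' (H' :: nat graph). is_fold_cover m G L' H' \<and>
           card (cover_colorings G H') = card (cover_colorings G H)"
proof -
  from assms have cov: "is_cover G L H" and fold: "\<forall>u \<in> verts G. finite (L u) \<and> card (L u) = m"
    by (auto simp: is_fold_cover_def)
  from cov have fin: "finite (verts H)"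
    and edge: "\<And>e. e \<in> edges H \<Longrightarrow> e \<subseteq> verts H \<and> card e = 2"
    and disj: "disjoint_family_on L (verts G)" and un: "(\<Union>u \<in> verts G. L u) = verts H"
    and compl: "\<And>u x y. u \<in> verts G \<Longrightarrow> x \<in> L u \<Longrightarrow> y \<in> L u \<Longrightarrow> x \<noteq> y \<Longrightarrow> {x, y} \<in> edges H"
    and cross: "\<And>u v. u \<in> verts G \<Longrightarrow> v \<in> verts G \<Longrightarrow> edges_between H (L u) (L v) \<noteq> {} \<Longrightarrow>
                  u = v \<or> {u, v} \<in> edges G"
    and mat: "\<And>u v. u \<in> verts G \<Longrightarrow> v \<in> verts G \<Longrightarrow> {u, v} \<in> edges G \<Longrightarrow>
                  is_matching (edges_between H (L u) (L v))"
    by (simp_all add: is_cover_def simple_graph_def)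
  obtain f :: "'b \<Rightarrow> nat" where f: "inj_on f (verts H)"
    using finite_imp_inj_to_nat_seg[OF fin] by blast
  have sub: "L u \<subseteq> verts H" if "u \<in> verts G" for u
    using un that by blast
  define H' where "H' = \<lparr> verts = f ` verts H, edges = (`) f ` edges H \<rparr>"
  define L' where "L' = (\<lambda>u. f ` L u)"
  have im_eq: "f ` A = f ` B \<longleftrightarrow> A = B" if "A \<subseteq> verts H" "B \<subseteq> verts H" for A B
    using inj_on_image_eq_iff[OF f that] .
  have edge_iff: "f ` A \<in> edges H' \<longleftrightarrow> A \<in> edges H" if "A \<subseteq> verts H" for A
    using that im_eq edge by (auto simp: H'_def)
  have edge_iff2: "{f x, f y} \<in> edges H' \<longleftrightarrow> {x, y} \<in> edges H"
    if "x \<in> verts H" "y \<in> verts H" for x y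
    using edge_iff[of "{x, y}"] that by simp
  have betw: "edges_between H' (L' u) (L' v) = (`) f ` edges_between H (L u) (L v)"
    if uv: "u \<in> verts G" "v \<in> verts G" for u v
  proof
    show "edges_between H' (L' u) (L' v) \<subseteq> (`) f ` edges_between H (L u) (L v)"
    proof
      fix e assume "e \<in> edges_between H' (L' u) (L' v)"
      then obtain a b where ab: "a \<in> L u" "b \<in> L v" "e = {f a, f b}" "{f a, f b} \<in> edges H'"
        by (auto simp: edges_between_def L'_def)
      moreover have "a \<in> verts H" "b \<in> verts H" using ab sub uv by auto
      ultimately have "{a, b} \<in> edges_between H (L u) (L v)"
        using edge_iff2 by (auto simp: edges_between_def)
      then show "e \<in> (`) f ` edges_between H (L u) (L v)"
        using ab(3) by (auto intro!: image_eqI[of _ _ "{a, b}"])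
    qed
    show "(`) f ` edges_between H (L u) (L v) \<subseteq> edges_between H' (L' u) (L' v)"
    proof
      fix e assume "e \<in> (`) f ` edges_between H (L u) (L v)"
      then obtain a b where "a \<in> L u" "b \<in> L v" "{a, b} \<in> edges H" "e = f ` {a, b}"
        by (auto simp: edges_between_def)
      moreover from this have "f ` {a, b} \<in> edges H'"
        unfolding H'_def by (simp only: graph.simps) (rule imageI)
      ultimately show "e \<in> edges_between H' (L' u) (L' v)"
        unfolding edges_between_def L'_def by auto
    qed
  qed
  have "simple_graph H'"
    unfolding simple_graph_def
  proof (intro conjI ballI)
    show "finite (verts H')" using fin by (simp add: H'_def)
    fix e assume "e \<in> edges H'"
    then obtain d where d: "d \<in> edges H" "e = f ` d" by (auto simp: H'_def)
    then show "e \<subseteq> verts H'" using edge by (auto simp: H'_def)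
    show "card e = 2"
      using d edge[of d] card_image[OF inj_on_subset[OF f]] by simp
  qed
  moreover have "disjoint_family_on L' (verts G)"
    unfolding disjoint_family_on_def
  proof (intro ballI impI)
    fix u v assume uv: "u \<in> verts G" "v \<in> verts G" "u \<noteq> v"
    have "L' u \<inter> L' v = f ` (L u \<inter> L v)"
      using inj_on_image_Int[OF f, of "L u" "L v"] sub uv by (simp add: L'_def)
    then show "L' u \<inter> L' v = {}"
      using disj uv by (simp add: disjoint_family_on_def)
  qed
  moreover have "(\<Union>u \<in> verts G. L' u) = verts H'"
    by (simp add: L'_def H'_def image_UN flip: un)
  moreover have "{x, y} \<in> edges H'"
    if u: "u \<in> verts G" and xy: "x \<in> L' u" "y \<in> L' u" "x \<noteq> y" for u x y
  proof -
    obtain a b where ab: "a \<in> L u" "b \<in> L u" "x = f a" "y = f b"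
      using xy by (auto simp: L'_def)
    then have "{a, b} \<in> edges H" using compl[OF u] xy(3) by blast
    moreover have "a \<in> verts H" "b \<in> verts H" using sub[OF u] ab by blast+
    ultimately show ?thesis using edge_iff2 ab by simp
  qed
  moreover have "u = v \<or> {u, v} \<in> edges G"
    if "u \<in> verts G" "v \<in> verts G" "edges_between H' (L' u) (L' v) \<noteq> {}" for u v
    using that cross[OF that(1,2)] betw[OF that(1,2)] by simp
  moreover have "is_matching (edges_between H' (L' u) (L' v))"
    if uv: "u \<in> verts G" "v \<in> verts G" "{u, v} \<in> edges G" for u v
  proof -
    have "disjnt (f ` d) (f ` e)"
      if "d \<in> edges_between H (L u) (L v)" "e \<in> edges_between H (L u) (L v)" "f ` d \<noteq> f ` e"
      for d e
    proof -
      have "disjnt d e"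
        using mat[OF uv] that unfolding is_matching_def pairwise_def by blast
      moreover have "d \<subseteq> verts H" "e \<subseteq> verts H"
        using that edge by (auto simp: edges_between_def)
      ultimately show ?thesis
        using inj_on_image_Int[OF f, of d e] by (simp add: disjnt_def)
    qed
    then show ?thesis
      unfolding betw[OF uv(1,2)] is_matching_def pairwise_def by blast
  qed
  ultimately have "is_cover G L' H'"
    unfolding is_cover_def by (intro conjI ballI impI)
  moreover have "finite (L' u) \<and> card (L' u) = m" if "u \<in> verts G" for u
    using fold sub[OF that] that card_image[OF inj_on_subset[OF f]] by (simp add: L'_def)
  ultimately have "is_fold_cover m G L' H'"
    by (simp add: is_fold_cover_def)
  moreover have "card (cover_colorings G H') = card (cover_colorings G H)"
  proof -
    have ind: "independent_set H' (f ` I) \<longleftrightarrow> independent_set H I" if "I \<subseteq> verts H" for I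
    proof -
      have "f ` I \<subseteq> verts H'" using that by (auto simp: H'_def)
      moreover have "{f x, f y} \<notin> edges H' \<longleftrightarrow> {x, y} \<notin> edges H" if "x \<in> I" "y \<in> I" for x y
        using edge_iff2 \<open>I \<subseteq> verts H\<close> that by blast
      ultimately show ?thesis
        using that by (simp add: independent_set_def)
    qed
    have "cover_colorings G H' = (`) f ` cover_colorings G H"
    proof
      show "cover_colorings G H' \<subseteq> (`) f ` cover_colorings G H"
      proof
        fix J assume J: "J \<in> cover_colorings G H'"
        then have "J \<subseteq> f ` verts H"
          by (simp add: cover_colorings_def independent_set_def H'_def)
        then obtain I where I: "I \<subseteq> verts H" "J = f ` I"
          by (auto simp: subset_image_iff)
        then have "I \<in> cover_colorings G H"
          using J ind card_image[OF inj_on_subset[OF f I(1)]] by (simp add: cover_colorings_def)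
        then show "J \<in> (`) f ` cover_colorings G H" using I by blast
      qed
      show "(`) f ` cover_colorings G H \<subseteq> cover_colorings G H'"
      proof
        fix J assume "J \<in> (`) f ` cover_colorings G H"
        then obtain I where I: "I \<in> cover_colorings G H" "J = f ` I" by blast
        then have "I \<subseteq> verts H" by (simp add: cover_colorings_def independent_set_def)
        then show "J \<in> cover_colorings G H'"
          using I ind card_image[OF inj_on_subset[OF f]] by (simp add: cover_colorings_def)
      qed
    qed
    moreover have "inj_on ((`) f) (cover_colorings G H)"
      using im_eq by (auto simp: inj_on_def cover_colorings_def independent_set_def)
    ultimately show ?thesis by (simp add: card_image)
  qed
  ultimately show ?thesis by blast
qed

lemma fold_cover_exists:
  assumes "simple_graph G"
  shows "\<exists>L (H :: nat graph). is_fold_cover m G L H"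
proof -
  define L where "L = (\<lambda>u :: 'a. {u} \<times> {..<m})"
  define H where "H = \<lparr> verts = verts G \<times> {..<m},
    edges = {{(u, i), (u, j)} | u i j. u \<in> verts G \<and> i < m \<and> j < m \<and> i \<noteq> j} \<rparr>"
  have fin: "finite (verts G)" using assms by (simp add: simple_graph_def)
  have loop: "{u, u} \<notin> edges G" for u
    using assms by (auto simp: simple_graph_def)
  have same: "u = v" if "edges_between H (L u) (L v) \<noteq> {}" for u v
    using that by (auto simp: edges_between_def H_def L_def doubleton_eq_iff)
  have "simple_graph H"
    using fin by (auto simp: simple_graph_def H_def)
  moreover have "disjoint_family_on L (verts G) \<and> (\<Union>u \<in> verts G. L u) = verts H"
    by (auto simp: disjoint_family_on_def L_def H_def)
  moreover have "\<forall>u \<in> verts G. \<forall>x \<in> L u. \<forall>y \<in> L u. x \<noteq> y \<longrightarrow> {x, y} \<in> edges H"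
    by (auto simp: L_def H_def)
  moreover have "is_matching (edges_between H (L u) (L v))" if "{u, v} \<in> edges G" for u v
  proof -
    have "edges_between H (L u) (L v) = {}" using same loop that by blast
    then show ?thesis by (simp add: is_matching_def)
  qed
  moreover have "u = v \<or> {u, v} \<in> edges G" if "edges_between H (L u) (L v) \<noteq> {}" for u v
    using same[OF that] by blast
  ultimately have "is_cover G L H"
    unfolding is_cover_def by simp
  then have "is_fold_cover m G L H"
    by (simp add: is_fold_cover_def L_def card_cartesian_product)
  then show ?thesis using fold_cover_nat by blast
qed

lemma simple_graph_generalized_theta:
  assumes "\<forall>l \<in> set ls. 1 \<le> l"
  shows "simple_graph (generalized_theta ls)"
proof -
  have "verts (generalized_theta ls) =
      {End1, End2} \<union> (\<Union>i<length ls. theta_path_vertex ls i ` {..ls ! i})"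
    by (auto simp: generalized_theta_def)
  then have "finite (verts (generalized_theta ls))"
    by simp
  moreover have "e \<subseteq> verts (generalized_theta ls) \<and> card e = 2"
    if ed: "e \<in> edges (generalized_theta ls)" for e
  proof -
    obtain i j where ij: "i < length ls" "j < ls ! i"
      and e: "e = {theta_path_vertex ls i j, theta_path_vertex ls i (Suc j)}"
      using ed by (auto simp: generalized_theta_def)
    have "theta_path_vertex ls i j \<noteq> theta_path_vertex ls i (Suc j)"
      using ij by (auto simp: theta_path_vertex_def)
    then have "card e = 2" using e by simp
    moreover have "theta_path_vertex ls i j \<in> verts (generalized_theta ls)"
      using ij unfolding generalized_theta_def by (force intro: less_imp_le)
    moreover have "theta_path_vertex ls i (Suc j) \<in> verts (generalized_theta ls)"
      using ij unfolding generalized_theta_def by (force intro: Suc_leI)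
    ultimately show ?thesis using e by simp
  qed
  ultimately show ?thesis by (simp add: simple_graph_def)
qed

end

theory Submission
  imports Defs
begin

text \<open>
  Adding edges to a cover only destroys colorings, so in a lower bound every matching may be taken
  perfect. The number of colorings of the \<open>i\<close>-th path with ends colored \<open>a\<close>, \<open>b\<close> is then
  \<open>B\<^sub>i + (-1)^l\<^sub>i [b = F\<^sub>i a]\<close>, where \<open>B\<^sub>i = ((m - 1)^l\<^sub>i - (-1)^l\<^sub>i) / m\<close> and \<open>F\<^sub>i\<close> is the composition of
  the matchings along the path. Multiplying over the three paths and summing over \<open>b\<close> gives a
  constant plus a sum over \<open>a\<close> of a term that depends only on which of \<open>F\<^sub>1 a\<close>, \<open>F\<^sub>2 a\<close>, \<open>F\<^sub>3 a\<close> coincide.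
  The parities decide which coincidence pattern makes this term smallest, and a cover whose
  \<open>F\<^sub>i\<close> are cyclic shifts realises that pattern for every \<open>a\<close> at once.
\<close>

section \<open>Path counts and the inequalities between them\<close>

text \<open>
  The number of colorings of a path of length \<open>l\<close> with prescribed end colors that do not
  correspond under the composed matchings.
\<close>

definition path_count :: "nat \<Rightarrow> nat \<Rightarrow> real" where
  "path_count m l = ((real m - 1) ^ l - (- 1) ^ l) / real m"

lemma path_count_0 [simp]: "path_count m 0 = 0"
  by (simp add: path_count_def)

lemma path_count_Suc:
  assumes "m > 0"
  shows "path_count m (Suc l) = (real m - 1) * path_count m l + (- 1) ^ l"
  using assms by (simp add: path_count_def field_simps)

text \<open>Already \<open>x ^ Suc l\<close> exceeds \<open>x ^ l\<close> by
  \<open>x ^ l * (x - 1)\<close>. With \<open>x = m - 1\<close> the gap pays for the sign terms when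
  path counts of opposite parity are compared.\<close>

lemma power_gap:
  fixes x :: real
  assumes "1 \<le> x" "l < l'"
  shows "x - 1 \<le> x ^ l' - x ^ l"
proof -
  have "x ^ Suc l \<le> x ^ l'" using assms by (intro power_increasing) auto
  moreover have "1 * (x - 1) \<le> x ^ l * (x - 1)"
    using assms by (intro mult_right_mono) auto
  ultimately show ?thesis by (simp add: algebra_simps)
qed

lemma path_count_nonneg: "2 \<le> m \<Longrightarrow> 0 \<le> path_count m l"
  using one_le_power[of "real m - 1" l] by (auto simp: path_count_def uminus_power_if)

lemma path_count_mono:
  assumes "2 \<le> m" "l \<le> l'" "even l = even l'"
  shows "path_count m l \<le> path_count m l'"
  using assms power_increasing[of l l' "real m - 1"]
  by (auto simp: path_count_def uminus_power_if divide_right_mono)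

text \<open>The left side counts the colorings of a path whose end colors do correspond. A single
  denominator makes it comparable with \<open>path_count\<close>.\<close>

lemma path_count_plus_sign:
  "2 \<le> m \<Longrightarrow> path_count m l + (- 1) ^ l = ((real m - 1) ^ l + (real m - 1) * (- 1) ^ l) / real m"
  by (simp add: path_count_def field_simps)

text \<open>With \<open>x = m - 1\<close> the numerators differ by
  \<open>x ^ l' - x ^ l + (1 - x) * (- 1) ^ l\<close>, nonnegative by \<open>power_gap\<close>. This
  settles the case in which \<open>l1\<close> alone has its parity.\<close>

lemma path_count_plus_sign_le:
  assumes "2 \<le> m" "l < l'" "even l \<noteq> even l'"
  shows "path_count m l + (- 1) ^ l \<le> path_count m l'"
  using assms power_gap[of "real m - 1" l l']
  unfolding path_count_plus_sign[OF assms(1)]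
  by (auto simp: path_count_def uminus_power_if intro!: divide_right_mono)

text \<open>The numerators differ as in \<open>path_count_plus_sign_le\<close>. The bound rules out
  full agreement of the three transports as a better pattern when \<open>l1\<close> shares its
  parity with exactly one other length.\<close>

lemma path_count_le_plus_sign:
  assumes "2 \<le> m" "l < l'" "even l \<noteq> even l'"
  shows "path_count m l \<le> path_count m l' + (- 1) ^ l'"
  using assms power_gap[of "real m - 1" l l']
  unfolding path_count_plus_sign[OF assms(1)]
  by (auto simp: path_count_def uminus_power_if intro!: divide_right_mono)

text \<open>For odd \<open>l\<close> the numerator is \<open>x ^ l - x\<close>, where
  \<open>x = m - 1\<close> is at least 1.\<close>

lemma path_count_plus_sign_nonneg:
  assumes "2 \<le> m" "0 < l"
  shows "0 \<le> path_count m l + (- 1) ^ l"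
  using assms power_increasing[of 1 l "real m - 1"]
  unfolding path_count_plus_sign[OF assms(1)]
  by (auto simp: uminus_power_if)

section \<open>Expanding the product over the three paths\<close>

text \<open>The part of the count that does not depend on the transports. The outer
  \<open>real m\<close> counts the colors of \<open>End1\<close>, the inner one those of
  \<open>End2\<close>; each single indicator in the color of \<open>End2\<close> contributes its
  coefficient once.\<close>

definition theta_base :: "nat \<Rightarrow> nat \<Rightarrow> nat \<Rightarrow> nat \<Rightarrow> real" where
  "theta_base m l1 l2 l3 = real m * (real m * (path_count m l1 * path_count m l2 * path_count m l3)
     + (- 1) ^ l1 * path_count m l2 * path_count m l3
     + (- 1) ^ l2 * path_count m l1 * path_count m l3
     + (- 1) ^ l3 * path_count m l1 * path_count m l2)"

text \<open>
  The contribution of a color \<open>a\<close> of \<open>End1\<close> that the three paths transport to \<open>b1\<close>, \<open>b2\<close>, \<open>b3\<close>.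
\<close>

definition theta_gain :: "nat \<Rightarrow> nat \<Rightarrow> nat \<Rightarrow> nat \<Rightarrow> 'b \<Rightarrow> 'b \<Rightarrow> 'b \<Rightarrow> real" where
  "theta_gain m l1 l2 l3 b1 b2 b3 =
     (- 1) ^ l1 * (- 1) ^ l2 * path_count m l3 * of_bool (b1 = b2)
     + (- 1) ^ l1 * (- 1) ^ l3 * path_count m l2 * of_bool (b1 = b3)
     + (- 1) ^ l2 * (- 1) ^ l3 * path_count m l1 * of_bool (b2 = b3)
     + (- 1) ^ l1 * (- 1) ^ l2 * (- 1) ^ l3 * of_bool (b1 = b2 \<and> b2 = b3)"

text \<open>In the expanded product \<open>of_bool (b = u) * of_bool (b = v)\<close> survives only
  at \<open>b = u\<close> and leaves \<open>of_bool (u = v)\<close>. Every single indicator sums to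
  1, as its point lies in \<open>T\<close>.\<close>

lemma sum_product_of_indicators:
  fixes p q r e g h :: real
  assumes "finite T" "card T = m" "u \<in> T" "v \<in> T" "w \<in> T"
  shows "(\<Sum>b\<in>T. (p + e * of_bool (b = u)) * (q + g * of_bool (b = v)) * (r + h * of_bool (b = w))) =
    real m * (p * q * r) + e * q * r + g * p * r + h * p * q + e * g * r * of_bool (u = v)
      + e * h * q * of_bool (u = w) + g * h * p * of_bool (v = w) + e * g * h * of_bool (u = v \<and> v = w)"
proof -
  have one: "(\<Sum>b\<in>T. of_bool (b = z) :: real) = 1" if "z \<in> T" for z
    using assms(1) that by (simp add: of_bool_def)
  \<comment> \<open>Each overlap is charged to the first of the coinciding indicators, so that only
    three single indicators with constant coefficients have to be summed.\<close>
  have "(p + e * of_bool (b = u)) * (q + g * of_bool (b = v)) * (r + h * of_bool (b = w)) =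
    p * q * r + (e * q * r + e * g * r * of_bool (u = v) + e * h * q * of_bool (u = w)
        + e * g * h * of_bool (u = v \<and> v = w)) * of_bool (b = u)
      + (g * p * r + g * h * p * of_bool (v = w)) * of_bool (b = v) + h * p * q * of_bool (b = w)" for b
    by (cases "b = u"; cases "b = v"; cases "b = w") (simp_all add: algebra_simps)
  then show ?thesis
    using assms by (simp add: sum.distrib one flip: sum_distrib_left)
qed

section \<open>Covers whose matchings are cyclic shifts\<close>

lemma mod_add_cancel_right_nat:
  fixes x y k m :: nat
  assumes "x < m" "y < m"
  shows "(x + k) mod m = (y + k) mod m \<longleftrightarrow> x = y"
proof -
  have *: "x = y" if xy: "x \<le> y" "y < m" and eq: "(y + k) mod m = (x + k) mod m" for x y
  proof (rule ccontr)
    assume "x \<noteq> y"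
    moreover have "m dvd y - x" using mod_eq_dvd_iff_nat[of "x + k" "y + k" m] xy eq by simp
    ultimately have "m \<le> y - x" using xy by (intro dvd_imp_le) auto
    with xy \<open>x \<noteq> y\<close> show False by simp
  qed
  show ?thesis
  proof
    assume eq: "(x + k) mod m = (y + k) mod m"
    show "x = y"
      using nat_le_linear[of x y] *[of x y] *[of y x] assms eq by auto
  qed simp
qed

text \<open>
  Color \<open>x\<close> at \<open>u\<close> is matched with \<open>x + t u v - t v u\<close> at \<open>v\<close>, modulo \<open>m\<close>; the two-sided form makes
  the edge relation symmetric for arbitrary \<open>t\<close> and avoids truncated subtraction.
\<close>

definition shift_cover :: "'a graph \<Rightarrow> nat \<Rightarrow> ('a \<Rightarrow> 'a \<Rightarrow> nat) \<Rightarrow> ('a \<times> nat) graph" where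
  "shift_cover G m t = \<lparr> verts = verts G \<times> {..<m},
     edges = {{(u, x), (u, y)} | u x y. u \<in> verts G \<and> x < m \<and> y < m \<and> x \<noteq> y} \<union>
       {{(u, x), (v, y)} | u v x y. {u, v} \<in> edges G \<and> x < m \<and> y < m \<and>
          (x + t u v) mod m = (y + t v u) mod m} \<rparr>"

lemma shift_cover_edge_iff:
  assumes "u \<noteq> v" "{u, v} \<in> edges G"
  shows "{(u, x), (v, y)} \<in> edges (shift_cover G m t) \<longleftrightarrow>
    x < m \<and> y < m \<and> (x + t u v) mod m = (y + t v u) mod m"
proof
  show "{(u, x), (v, y)} \<in> edges (shift_cover G m t) \<Longrightarrow>
      x < m \<and> y < m \<and> (x + t u v) mod m = (y + t v u) mod m"
    using assms(1) by (auto simp: shift_cover_def doubleton_eq_iff)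
  show "x < m \<and> y < m \<and> (x + t u v) mod m = (y + t v u) mod m \<Longrightarrow>
      {(u, x), (v, y)} \<in> edges (shift_cover G m t)"
    unfolding shift_cover_def graph.simps using assms(2)
    by (intro UnI2 CollectI exI[of _ u] exI[of _ v] exI[of _ x] exI[of _ y]) simp
qed

text \<open>Adding a constant is injective modulo \<open>m\<close>, so an edge between two fibres is
  determined by either of its ends; this is the matching condition.\<close>

lemma is_fold_cover_shift_cover:
  assumes G: "simple_graph G"
  shows "is_fold_cover m G (\<lambda>u. {u} \<times> {..<m}) (shift_cover G m t)"
proof -
  let ?H = "shift_cover G m t" and ?L = "\<lambda>u. {u} \<times> {..<m}"
  have fin: "finite (verts G)" and sub: "\<And>u v. {u, v} \<in> edges G \<Longrightarrow> u \<in> verts G \<and> v \<in> verts G \<and> u \<noteq> v"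
    using G by (auto simp: simple_graph_def)
  have "simple_graph ?H"
    using fin sub by (fastforce simp: simple_graph_def shift_cover_def)
  moreover have "disjoint_family_on ?L (verts G)" "(\<Union>u \<in> verts G. ?L u) = verts ?H"
    by (auto simp: disjoint_family_on_def shift_cover_def)
  moreover have "\<forall>u \<in> verts G. \<forall>x \<in> ?L u. \<forall>y \<in> ?L u. x \<noteq> y \<longrightarrow> {x, y} \<in> edges ?H"
    by (auto simp: shift_cover_def)
  moreover have "u = v \<or> {u, v} \<in> edges G" if "edges_between ?H (?L u) (?L v) \<noteq> {}" for u v
    using that by (auto simp: edges_between_def shift_cover_def doubleton_eq_iff insert_commute)
  moreover have "is_matching (edges_between ?H (?L u) (?L v))" if e: "{u, v} \<in> edges G" for u v
  proof -
    have "d = e'" if d: "d \<in> edges_between ?H (?L u) (?L v)"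
      and e': "e' \<in> edges_between ?H (?L u) (?L v)" and nd: "\<not> disjnt d e'" for d e'
    proof -
      have uv: "u \<noteq> v" using sub[OF e] by blast
      obtain x y where xy: "d = {(u, x), (v, y)}" "x < m" "y < m"
        "(x + t u v) mod m = (y + t v u) mod m"
        using d shift_cover_edge_iff[OF uv e] by (auto simp: edges_between_def)
      obtain x' y' where xy': "e' = {(u, x'), (v, y')}" "x' < m" "y' < m"
        "(x' + t u v) mod m = (y' + t v u) mod m"
        using e' shift_cover_edge_iff[OF uv e] by (auto simp: edges_between_def)
      have "x = x' \<or> y = y'" using nd uv by (auto simp: xy(1) xy'(1) disjnt_def)
      then have "x = x' \<and> y = y'"
        using mod_add_cancel_right_nat xy(2-4) xy'(2-4) by metis
      then show ?thesis by (simp add: xy(1) xy'(1))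
    qed
    then show ?thesis unfolding is_matching_def pairwise_def by blast
  qed
  ultimately show ?thesis
    by (simp add: is_fold_cover_def is_cover_def)
qed

section \<open>The minimum over covers, and colorings as choice functions\<close>

text \<open>The minimizing cover may live over any vertex type, since \<open>fold_cover_nat\<close>
  moves it to the naturals with the same count. Explicit covers can therefore use pairs as
  vertices.\<close>

lemma dp_color_function_eqI:
  fixes L :: "'a \<Rightarrow> 'b set" and H :: "'b graph"
  assumes "is_fold_cover m G L H"
    and "\<And>L' (H' :: nat graph). is_fold_cover m G L' H' \<Longrightarrow>
      card (cover_colorings G H) \<le> card (cover_colorings G H')"
  shows "dp_color_function G m = card (cover_colorings G H)"
  unfolding dp_color_function_def
proof (rule Least_equality)
  show "\<exists>L' (H' :: nat graph). is_fold_cover m G L' H' \<and>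
      card (cover_colorings G H) = card (cover_colorings G H')"
    using fold_cover_nat[OF assms(1)] by metis
qed (use assms(2) in auto)

text \<open>An independent set meets every clique \<open>L u\<close> at most once, so
  \<open>card (verts G)\<close> elements force it to meet each exactly once: it is the image of a
  unique choice function.\<close>

lemma card_cover_colorings:
  assumes cov: "is_cover G L H" and fin: "finite (verts G)"
  shows "card (cover_colorings G H) = card {c \<in> PiE (verts G) L.
    \<forall>u \<in> verts G. \<forall>v \<in> verts G. {u, v} \<in> edges G \<longrightarrow> {c u, c v} \<notin> edges H}"
    (is "_ = card ?T")
proof -
  have edge: "\<And>e. e \<in> edges H \<Longrightarrow> e \<subseteq> verts H \<and> card e = 2"
    and disj: "disjoint_family_on L (verts G)" and un: "(\<Union>u \<in> verts G. L u) = verts H"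
    and compl: "\<And>u x y. u \<in> verts G \<Longrightarrow> x \<in> L u \<Longrightarrow> y \<in> L u \<Longrightarrow> x \<noteq> y \<Longrightarrow> {x, y} \<in> edges H"
    and cross: "\<And>u v. u \<in> verts G \<Longrightarrow> v \<in> verts G \<Longrightarrow> edges_between H (L u) (L v) \<noteq> {} \<Longrightarrow>
                  u = v \<or> {u, v} \<in> edges G"
    using cov by (simp_all add: is_cover_def simple_graph_def)
  have owner: "u = v" if "x \<in> L u" "x \<in> L v" "u \<in> verts G" "v \<in> verts G" for x u v
    using disj that by (auto simp: disjoint_family_on_def)
  have mem: "c u \<in> L u" if "c \<in> ?T" "u \<in> verts G" for c u
    using that by auto
  have "bij_betw (\<lambda>c. c ` verts G) ?T (cover_colorings G H)"
    unfolding bij_betw_def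
  proof
    show "inj_on (\<lambda>c. c ` verts G) ?T"
    proof (rule inj_onI)
      fix c d assume c: "c \<in> ?T" and d: "d \<in> ?T" and eq: "c ` verts G = d ` verts G"
      show "c = d"
      proof (rule PiE_ext)
        show "c \<in> PiE (verts G) L" "d \<in> PiE (verts G) L" using c d by auto
        fix u assume u: "u \<in> verts G"
        then obtain v where v: "v \<in> verts G" "c u = d v" using eq by blast
        then have "u = v" using owner mem[OF c u] mem[OF d] u by metis
        with v show "c u = d u" by simp
      qed
    qed
    show "(\<lambda>c. c ` verts G) ` ?T = cover_colorings G H"
    proof
      show "(\<lambda>c. c ` verts G) ` ?T \<subseteq> cover_colorings G H"
      proof (rule image_subsetI)
        fix c assume c: "c \<in> ?T"
        have "inj_on c (verts G)"
          using mem[OF c] owner by (intro inj_onI) metis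
        moreover have "c ` verts G \<subseteq> verts H"
          using mem[OF c] un by blast
        \<comment> \<open>Only edges of \<open>G\<close> need checking: by \<open>cross\<close>,
          other fibres are joined by no edge, and for \<open>u = v\<close> the pair collapses to a
          singleton.\<close>
        moreover have "{c u, c v} \<notin> edges H" if uv: "u \<in> verts G" "v \<in> verts G" for u v
        proof
          assume e: "{c u, c v} \<in> edges H"
          then have "edges_between H (L u) (L v) \<noteq> {}"
            using mem[OF c] uv by (auto simp: edges_between_def)
          with cross uv have "u = v \<or> {u, v} \<in> edges G" by blast
          moreover have "u \<noteq> v" using edge[OF e] by auto
          ultimately show False using c e uv by blast
        qed
        ultimately show "c ` verts G \<in> cover_colorings G H"
          by (auto simp: cover_colorings_def independent_set_def card_image)
      qed
      show "cover_colorings G H \<subseteq> (\<lambda>c. c ` verts G) ` ?T"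
      proof
        fix I assume "I \<in> cover_colorings G H"
        then have sub: "I \<subseteq> verts H" and ind: "\<And>x y. x \<in> I \<Longrightarrow> y \<in> I \<Longrightarrow> {x, y} \<notin> edges H"
          and card: "card I = card (verts G)"
          by (auto simp: cover_colorings_def independent_set_def)
        have "\<forall>x \<in> I. \<exists>u. u \<in> verts G \<and> x \<in> L u" using sub un by blast
        then obtain own where own: "\<And>x. x \<in> I \<Longrightarrow> own x \<in> verts G \<and> x \<in> L (own x)" by metis
        have uniq: "x = y" if "x \<in> I" "y \<in> I" "u \<in> verts G" "x \<in> L u" "y \<in> L u" for x y u
          using compl ind that by blast
        \<comment> \<open>Two elements with the same owner would be adjacent. Injectivity together
          with the cardinality of \<open>I\<close> makes \<open>own\<close> onto.\<close>
        have "inj_on own I"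
          using own uniq by (intro inj_onI) metis
        then have "card (own ` I) = card (verts G)" by (simp add: card_image card)
        then have "own ` I = verts G"
          using own by (intro card_subset_eq fin) auto
        then have "\<forall>u \<in> verts G. \<exists>x \<in> I. x \<in> L u" using own by (metis imageE)
        then obtain c where c: "\<And>u. u \<in> verts G \<Longrightarrow> c u \<in> I \<and> c u \<in> L u" by metis
        have "restrict c (verts G) \<in> ?T" using c ind by auto
        moreover have "restrict c (verts G) ` verts G = I"
        proof
          show "restrict c (verts G) ` verts G \<subseteq> I" using c by auto
          show "I \<subseteq> restrict c (verts G) ` verts G"
          proof
            fix x assume x: "x \<in> I"
            then have "x = c (own x)" using own c uniq by metis
            then show "x \<in> restrict c (verts G) ` verts G" using own[OF x] by auto
          qed
        qed
        ultimately show "I \<in> (\<lambda>c. c ` verts G) ` ?T" by blast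
      qed
    qed
  qed
  then show ?thesis by (simp add: bij_betw_same_card)
qed

section \<open>Completing matchings to bijections\<close>

text \<open>\<open>R\<close> is an injective partial function. Its domain and image have equal size,
  hence so do their complements, and any bijection \<open>h\<close> between these completes
  it.\<close>

lemma partial_matching_extends_to_bijection:
  assumes fin: "finite A" "finite B" and card: "card A = card B"
    and right_unique: "\<And>x y y'. x \<in> A \<Longrightarrow> y \<in> B \<Longrightarrow> y' \<in> B \<Longrightarrow> R x y \<Longrightarrow> R x y' \<Longrightarrow> y = y'"
    and left_unique: "\<And>x x' y. x \<in> A \<Longrightarrow> x' \<in> A \<Longrightarrow> y \<in> B \<Longrightarrow> R x y \<Longrightarrow> R x' y \<Longrightarrow> x = x'"
  shows "\<exists>f. bij_betw f A B \<and> (\<forall>x \<in> A. \<forall>y \<in> B. R x y \<longrightarrow> y = f x)"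
proof -
  define D where "D = {x \<in> A. \<exists>y \<in> B. R x y}"
  have "\<forall>x \<in> D. \<exists>y. y \<in> B \<and> R x y" by (auto simp: D_def)
  then obtain g where g: "\<And>x. x \<in> D \<Longrightarrow> g x \<in> B \<and> R x (g x)" by metis
  have DA: "D \<subseteq> A" by (auto simp: D_def)
  have gB: "g ` D \<subseteq> B" using g by auto
  have inj: "inj_on g D"
  proof (rule inj_onI)
    fix x y assume "x \<in> D" "y \<in> D" "g x = g y"
    then show "x = y" using g[of x] g[of y] left_unique[of x y "g x"] DA by auto
  qed
  have "card (A - D) = card (B - g ` D)"
    using fin card DA gB finite_subset[OF DA] by (simp add: card_Diff_subset card_image inj)
  then obtain h where h: "bij_betw h (A - D) (B - g ` D)"
    using fin finite_same_card_bij[of "A - D" "B - g ` D"] by auto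
  define f where "f = (\<lambda>x. if x \<in> D then g x else h x)"
  have "bij_betw f D (g ` D)"
    using inj by (auto simp: bij_betw_def f_def inj_on_def)
  moreover have "bij_betw f (A - D) (B - g ` D)"
    using h by (subst bij_betw_cong[where g = h]) (auto simp: f_def)
  ultimately have "bij_betw f (D \<union> (A - D)) (g ` D \<union> (B - g ` D))"
    by (rule bij_betw_combine) auto
  moreover have "D \<union> (A - D) = A" "g ` D \<union> (B - g ` D) = B" using DA gB by auto
  moreover have "y = f x" if xy: "x \<in> A" "y \<in> B" "R x y" for x y
  proof -
    have "x \<in> D" using xy by (auto simp: D_def)
    then show ?thesis using right_unique[of x y "g x"] xy g by (auto simp: f_def)
  qed
  ultimately show ?thesis by auto
qed

lemma matching_unique:
  assumes "is_matching (edges_between H A B)" "x \<in> A" "y \<in> B" "x' \<in> A" "y' \<in> B"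
    "{x, y} \<in> edges H" "{x', y'} \<in> edges H" "x = x' \<or> y = y'"
  shows "{x, y} = {x', y'}"
proof -
  have "{x, y} \<in> edges_between H A B" "{x', y'} \<in> edges_between H A B"
    using assms by (auto simp: edges_between_def)
  moreover have "\<not> disjnt {x, y} {x', y'}" using assms(8) by (auto simp: disjnt_def)
  ultimately show ?thesis
    using pairwiseD[of disjnt "edges_between H A B"] assms(1) unfolding is_matching_def by metis
qed

section \<open>Counting the colorings of one path\<close>

text \<open>\<open>S j\<close> is the list of colors at position \<open>j\<close>, and
  \<open>f j\<close> sends a color there to the one color that it forbids at position
  \<open>Suc j\<close>.\<close>

definition path_colorings ::
  "nat \<Rightarrow> (nat \<Rightarrow> 'b set) \<Rightarrow> (nat \<Rightarrow> 'b \<Rightarrow> 'b) \<Rightarrow> 'b \<Rightarrow> 'b \<Rightarrow> (nat \<Rightarrow> 'b) set" where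
  "path_colorings l S f a b =
     {w \<in> PiE {..l} S. w 0 = a \<and> w l = b \<and> (\<forall>j<l. w (Suc j) \<noteq> f j (w j))}"

primrec transport :: "(nat \<Rightarrow> 'b \<Rightarrow> 'b) \<Rightarrow> nat \<Rightarrow> 'b \<Rightarrow> 'b" where
  "transport f 0 x = x"
| "transport f (Suc j) x = f j (transport f j x)"

lemma transport_in:
  assumes "\<And>j. j < l \<Longrightarrow> bij_betw (f j) (S j) (S (Suc j))" "a \<in> S 0"
  shows "transport f l a \<in> S l"
  using assms
proof (induction l)
  case (Suc l)
  then have "transport f l a \<in> S l" by simp
  then show ?case using Suc.prems(1)[of l] by (auto dest: bij_betwE)
qed simp

lemma finite_path_colorings:
  assumes "\<And>j. j \<le> l \<Longrightarrow> finite (S j)"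
  shows "finite (path_colorings l S f a b)"
proof -
  have "finite (PiE {..l} S)"
    using assms by (intro finite_PiE) auto
  then show ?thesis
    by (simp add: path_colorings_def)
qed

lemma path_colorings_Suc:
  assumes "b \<in> S (Suc l)"
  shows "path_colorings (Suc l) S f a b =
    (\<lambda>w. w(Suc l := b)) ` (\<Union>c \<in> {c \<in> S l. f l c \<noteq> b}. path_colorings l S f a c)"
    (is "?A = ?g ` ?U")
proof
  show "?A \<subseteq> ?g ` ?U"
  proof
    fix w assume w: "w \<in> ?A"
    have "restrict w {..l} \<in> path_colorings l S f a (w l)"
      using w by (auto simp: path_colorings_def)
    moreover have "w l \<in> S l" "f l (w l) \<noteq> b"
      using w by (auto simp: path_colorings_def)
    moreover have "w = ?g (restrict w {..l})"
    proof
      fix x show "w x = ?g (restrict w {..l}) x"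
        using w by (auto simp: path_colorings_def PiE_def extensional_def)
    qed
    ultimately show "w \<in> ?g ` ?U" by blast
  qed
  show "?g ` ?U \<subseteq> ?A"
    using assms by (force simp: path_colorings_def PiE_iff extensional_def less_Suc_eq le_Suc_eq)
qed

lemma card_path_colorings_Suc:
  assumes "b \<in> S (Suc l)" and fin: "\<And>j. j \<le> l \<Longrightarrow> finite (S j)"
  shows "card (path_colorings (Suc l) S f a b) =
    (\<Sum>c \<in> {c \<in> S l. f l c \<noteq> b}. card (path_colorings l S f a c))"
proof -
  let ?U = "\<Union>c \<in> {c \<in> S l. f l c \<noteq> b}. path_colorings l S f a c"
  have "inj_on (\<lambda>w. w(Suc l := b)) ?U"
  proof (rule inj_onI)
    fix v w assume vw: "v \<in> ?U" "w \<in> ?U" and eq: "v(Suc l := b) = w(Suc l := b)"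
    \<comment> \<open>Both functions are extensional on \<open>{..l}\<close>, hence
      \<open>undefined\<close> at \<open>Suc l\<close>, so the update loses no information.\<close>
    have "v (Suc l) = w (Suc l)"
      using vw by (auto simp: path_colorings_def PiE_def extensional_def)
    then show "v = w"
      using eq by (metis fun_upd_triv fun_upd_upd)
  qed
  then have "card (path_colorings (Suc l) S f a b) = card ?U"
    by (simp add: path_colorings_Suc[where S = S and l = l, OF assms(1)] card_image)
  also have "\<dots> = (\<Sum>c \<in> {c \<in> S l. f l c \<noteq> b}. card (path_colorings l S f a c))"
    using fin by (intro card_UN_disjoint ballI finite_path_colorings impI)
      (auto simp: path_colorings_def)
  finally show ?thesis .
qed

text \<open>Induction on \<open>l\<close>: exactly one color \<open>c0\<close> of the previous
  vertex forbids \<open>b\<close>, so the count is the sum over all of \<open>S l\<close> minus the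
  term of \<open>c0\<close>. This is the recursion \<open>path_count_Suc\<close>, and the
  subtraction flips the sign of the indicator.\<close>

lemma card_path_colorings:
  assumes "\<And>j. j < l \<Longrightarrow> bij_betw (f j) (S j) (S (Suc j))"
    and "\<And>j. j \<le> l \<Longrightarrow> finite (S j) \<and> card (S j) = m"
    and "a \<in> S 0" "b \<in> S l"
  shows "real (card (path_colorings l S f a b)) =
    path_count m l + (- 1) ^ l * of_bool (b = transport f l a)"
  using assms
proof (induction l arbitrary: b)
  case 0
  have "path_colorings 0 S f a b = (if a = b then {\<lambda>j\<in>{0}. a} else {})"
    using 0 by (auto simp: path_colorings_def PiE_iff extensional_def fun_eq_iff)
  then show ?case by auto
next
  case (Suc l)
  define t where "t = transport f l a"
  have bij: "bij_betw (f l) (S l) (S (Suc l))" using Suc.prems(1) by simp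
  have fin: "finite (S l)" and m: "card (S l) = m" using Suc.prems(2)[of l] by auto
  have t: "t \<in> S l"
    unfolding t_def using Suc.prems by (intro transport_in) auto
  with fin m have "m > 0" by (auto simp: card_gt_0_iff)
  obtain c0 where c0: "c0 \<in> S l" "f l c0 = b"
    using bij_betw_imp_surj_on[OF bij] Suc.prems(4) by (metis imageE)
  have inj: "f l c = b \<longleftrightarrow> c = c0" if "c \<in> S l" for c
    using inj_on_eq_iff[OF bij_betw_imp_inj_on[OF bij] that c0(1)] c0(2) by simp
  have set: "{c \<in> S l. f l c \<noteq> b} = S l - {c0}" using inj by blast
  have "real (card (path_colorings (Suc l) S f a b)) =
      (\<Sum>c \<in> S l - {c0}. real (card (path_colorings l S f a c)))"
    using card_path_colorings_Suc[of b S l f a] Suc.prems by (simp add: set)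
  also have "\<dots> = (\<Sum>c \<in> S l - {c0}. path_count m l + (- 1) ^ l * of_bool (c = t))"
    unfolding t_def using Suc.prems by (intro sum.cong refl Suc.IH) auto
  also have "\<dots> = (\<Sum>c \<in> S l. path_count m l + (- 1) ^ l * of_bool (c = t)) -
      (path_count m l + (- 1) ^ l * of_bool (c0 = t))"
    using fin c0 by (simp add: sum_diff1)
  also have "\<dots> = real m * path_count m l + (- 1) ^ l -
      (path_count m l + (- 1) ^ l * of_bool (c0 = t))"
  proof -
    have "(\<Sum>c \<in> S l. of_bool (c = t) :: real) = 1"
      using fin t by (simp add: of_bool_def)
    then show ?thesis
      using m by (simp add: sum.distrib flip: sum_distrib_left)
  qed
  also have "\<dots> = path_count m (Suc l) + (- 1) ^ Suc l * of_bool (b = f l t)"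
    using inj[OF t] \<open>m > 0\<close> by (auto simp: path_count_Suc algebra_simps)
  finally show ?case by (simp add: t_def)
qed

section \<open>Splitting a coloring into its paths\<close>

text \<open>Path \<open>i\<close> is oriented from \<open>End1\<close> to \<open>End2\<close>;
  \<open>f i j\<close> stands for the matching along its \<open>j\<close>-th edge.\<close>

definition theta_colorings ::
  "nat list \<Rightarrow> (theta_vertex \<Rightarrow> 'b set) \<Rightarrow> (nat \<Rightarrow> nat \<Rightarrow> 'b \<Rightarrow> 'b) \<Rightarrow> (theta_vertex \<Rightarrow> 'b) set" where
  "theta_colorings ls S f = {c \<in> PiE (verts (generalized_theta ls)) S.
     \<forall>i<length ls. \<forall>j<ls ! i.
       c (theta_path_vertex ls i (Suc j)) \<noteq> f i j (c (theta_path_vertex ls i j))}"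

lemma theta_path_vertex_0 [simp]: "theta_path_vertex ls i 0 = End1"
  by (simp add: theta_path_vertex_def)

lemma theta_path_vertex_last: "0 < ls ! i \<Longrightarrow> theta_path_vertex ls i (ls ! i) = End2"
  by (simp add: theta_path_vertex_def)

lemma theta_path_vertex_in:
  "i < length ls \<Longrightarrow> j \<le> ls ! i \<Longrightarrow> theta_path_vertex ls i j \<in> verts (generalized_theta ls)"
  by (auto simp: generalized_theta_def)

lemma theta_ends_in: "End1 \<in> verts (generalized_theta ls)" "End2 \<in> verts (generalized_theta ls)"
  by (auto simp: generalized_theta_def)

lemma theta_vertex_cases:
  assumes "v \<in> verts (generalized_theta ls)"
  obtains "v = End1" | "v = End2"
  | i j where "v = Inner i j" "i < length ls" "0 < j" "j < ls ! i" "theta_path_vertex ls i j = v"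
proof -
  consider "v = End1" | "v = End2"
    | i j where "i < length ls" "j \<le> ls ! i" "v = theta_path_vertex ls i j"
    using assms by (auto simp: generalized_theta_def)
  then show thesis
  proof cases
    case 3
    show thesis
    proof (cases "j = 0 \<or> j = ls ! i")
      case True
      then show thesis using 3 that(1,2) by (auto simp: theta_path_vertex_def split: if_splits)
    next
      case False
      then show thesis using 3 that(3)[of i j] by (simp add: theta_path_vertex_def)
    qed
  qed (use that in blast)+
qed

text \<open>Once both end colors are fixed, the paths are colored independently. \<open>enc\<close>
  splits a coloring into its end colors and its restrictions to the paths, and \<open>dec\<close>
  glues them together.\<close>

lemma card_theta_colorings:
  assumes pos: "\<And>i. i < length ls \<Longrightarrow> 0 < ls ! i"
    and fin: "\<And>v. v \<in> verts (generalized_theta ls) \<Longrightarrow> finite (S v)"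
  shows "card (theta_colorings ls S f) = (\<Sum>a \<in> S End1. \<Sum>b \<in> S End2. \<Prod>i<length ls.
    card (path_colorings (ls ! i) (\<lambda>j. S (theta_path_vertex ls i j)) (f i) a b))"
proof -
  define V where "V = verts (generalized_theta ls)"
  define W where "W = (\<lambda>a b i. path_colorings (ls ! i) (\<lambda>j. S (theta_path_vertex ls i j)) (f i) a b)"
  define P where "P = (SIGMA a : S End1. SIGMA b : S End2. PiE {..<length ls} (W a b))"
  define enc where "enc = (\<lambda>c :: theta_vertex \<Rightarrow> 'a. (c End1, c End2,
    \<lambda>i\<in>{..<length ls}. \<lambda>j\<in>{..ls ! i}. c (theta_path_vertex ls i j)))"
  define dec where "dec = (\<lambda>(a, b, w :: nat \<Rightarrow> nat \<Rightarrow> 'a). \<lambda>v\<in>V.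
    case v of End1 \<Rightarrow> a | End2 \<Rightarrow> b | Inner i j \<Rightarrow> w i j)"
  \<comment> \<open>\<open>dec\<close> takes the end colors from \<open>a\<close> and
    \<open>b\<close>; membership in \<open>W a b i\<close> ensures that every path coloring agrees
    with them at positions \<open>0\<close> and \<open>ls ! i\<close>.\<close>
  have dec_path: "dec (a, b, w) (theta_path_vertex ls i j) = w i j"
    if w: "w \<in> PiE {..<length ls} (W a b)" and i: "i < length ls" "j \<le> ls ! i" for a b w i j
  proof -
    have "w i \<in> W a b i" using w i by auto
    then have "w i 0 = a" "w i (ls ! i) = b" by (auto simp: W_def path_colorings_def)
    moreover have "theta_path_vertex ls i j \<in> V" using i by (simp add: V_def theta_path_vertex_in)
    ultimately show ?thesis using i
      by (auto simp: dec_def theta_path_vertex_def)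
  qed
  have "bij_betw enc (theta_colorings ls S f) P"
  proof (rule bij_betw_byWitness[where f' = dec])
    show "\<forall>c \<in> theta_colorings ls S f. dec (enc c) = c"
    proof
      fix c assume "c \<in> theta_colorings ls S f"
      then have ext: "c \<in> extensional V" by (auto simp: theta_colorings_def V_def PiE_def)
      show "dec (enc c) = c"
      proof
        fix v show "dec (enc c) v = c v"
        proof (cases "v \<in> V")
          case True
          then show ?thesis unfolding V_def
            by (cases rule: theta_vertex_cases) (use True in \<open>auto simp: dec_def enc_def\<close>)
        next
          case False
          then show ?thesis using ext by (auto simp: dec_def enc_def extensional_def)
        qed
      qed
    qed
    show "\<forall>p \<in> P. enc (dec p) = p"
    proof
      fix p assume "p \<in> P"
      then obtain a b w where p: "p = (a, b, w)" and w: "w \<in> PiE {..<length ls} (W a b)"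
        by (auto simp: P_def)
      have "(\<lambda>i\<in>{..<length ls}. \<lambda>j\<in>{..ls ! i}. dec (a, b, w) (theta_path_vertex ls i j)) = w"
      proof
        fix i
        show "(\<lambda>i\<in>{..<length ls}. \<lambda>j\<in>{..ls ! i}. dec (a, b, w) (theta_path_vertex ls i j)) i = w i"
        proof (cases "i < length ls")
          case True
          then have "w i \<in> extensional {..ls ! i}"
            using w by (auto simp: W_def path_colorings_def PiE_iff)
          then show ?thesis using True dec_path[OF w]
            by (auto simp: fun_eq_iff extensional_def)
        next
          case False
          then show ?thesis using w by (auto simp: PiE_iff extensional_def)
        qed
      qed
      moreover have "dec (a, b, w) End1 = a" "dec (a, b, w) End2 = b"
        by (auto simp: dec_def V_def theta_ends_in)
      ultimately show "enc (dec p) = p" by (simp add: enc_def p)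
    qed
    show "enc ` theta_colorings ls S f \<subseteq> P"
    proof
      fix p assume "p \<in> enc ` theta_colorings ls S f"
      then obtain c where c: "c \<in> theta_colorings ls S f" "p = enc c" by blast
      have S: "c v \<in> S v" if "v \<in> V" for v
        using c that by (auto simp: theta_colorings_def V_def)
      have "(\<lambda>j\<in>{..ls ! i}. c (theta_path_vertex ls i j)) \<in> W (c End1) (c End2) i"
        if "i < length ls" for i
        using that c S pos[OF that] by (auto simp: W_def path_colorings_def theta_colorings_def V_def
            theta_path_vertex_in theta_path_vertex_last)
      then show "p \<in> P"
        using c S theta_ends_in[of ls] by (auto simp: P_def enc_def V_def)
    qed
    show "dec ` P \<subseteq> theta_colorings ls S f"
    proof
      fix c assume "c \<in> dec ` P"
      then obtain a b w where c: "c = dec (a, b, w)" and a: "a \<in> S End1" "b \<in> S End2"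
        and w: "w \<in> PiE {..<length ls} (W a b)"
        by (auto simp: P_def)
      have wi: "w i \<in> W a b i" if "i < length ls" for i using w that by auto
      have "c v \<in> S v" if v: "v \<in> V" for v
        using v unfolding V_def
      proof (cases rule: theta_vertex_cases)
        case (3 i j)
        then have "w i \<in> (\<Pi>\<^sub>E j\<in>{..ls ! i}. S (theta_path_vertex ls i j))"
          using wi[of i] by (auto simp: W_def path_colorings_def)
        then have "w i j \<in> S (theta_path_vertex ls i j)"
          by (rule PiE_mem) (use \<open>j < ls ! i\<close> in simp)
        then show ?thesis using 3 dec_path[OF w, of i j] by (simp add: c)
      qed (use a v in \<open>auto simp: c dec_def\<close>)
      moreover have "c \<in> extensional V" by (auto simp: c dec_def)
      moreover have "c (theta_path_vertex ls i (Suc j)) \<noteq> f i j (c (theta_path_vertex ls i j))"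
        if "i < length ls" "j < ls ! i" for i j
        using wi[OF that(1)] that dec_path[OF w that(1)] by (auto simp: c W_def path_colorings_def)
      ultimately show "c \<in> theta_colorings ls S f"
        by (auto simp: theta_colorings_def V_def PiE_iff)
    qed
  qed
  then have "card (theta_colorings ls S f) = card P"
    by (rule bij_betw_same_card)
  also have "\<dots> = (\<Sum>a \<in> S End1. \<Sum>b \<in> S End2. \<Prod>i<length ls. card (W a b i))"
  proof -
    have "finite (PiE {..<length ls} (W a b))" for a b
      using fin by (intro finite_PiE) (auto simp: W_def theta_path_vertex_in intro!: finite_path_colorings)
    then show ?thesis
      using fin theta_ends_in[of ls] by (simp add: P_def card_PiE)
  qed
  finally show ?thesis by (simp add: W_def)
qed

section \<open>From covers to transition maps\<close>

definition bijective_transitions ::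
  "nat list \<Rightarrow> nat \<Rightarrow> (theta_vertex \<Rightarrow> 'b set) \<Rightarrow> (nat \<Rightarrow> nat \<Rightarrow> 'b \<Rightarrow> 'b) \<Rightarrow> bool" where
  "bijective_transitions ls m S f \<longleftrightarrow>
     (\<forall>v \<in> verts (generalized_theta ls). finite (S v) \<and> card (S v) = m) \<and>
     (\<forall>i<length ls. \<forall>j<ls ! i.
        bij_betw (f i j) (S (theta_path_vertex ls i j)) (S (theta_path_vertex ls i (Suc j))))"

lemma theta_edge_in:
  "i < length ls \<Longrightarrow> j < ls ! i \<Longrightarrow>
    {theta_path_vertex ls i j, theta_path_vertex ls i (Suc j)} \<in> edges (generalized_theta ls)"
  by (auto simp: generalized_theta_def)

text \<open>Symmetry of \<open>P\<close> allows each edge to be checked in one direction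
  only.\<close>

lemma theta_edge_all_iff:
  assumes "\<And>u v. P u v \<longleftrightarrow> P v u"
  shows "(\<forall>u v. {u, v} \<in> edges (generalized_theta ls) \<longrightarrow> P u v) \<longleftrightarrow>
    (\<forall>i<length ls. \<forall>j<ls ! i. P (theta_path_vertex ls i (Suc j)) (theta_path_vertex ls i j))"
proof
  assume r: "\<forall>i<length ls. \<forall>j<ls ! i. P (theta_path_vertex ls i (Suc j)) (theta_path_vertex ls i j)"
  show "\<forall>u v. {u, v} \<in> edges (generalized_theta ls) \<longrightarrow> P u v"
  proof (intro allI impI)
    fix u v assume "{u, v} \<in> edges (generalized_theta ls)"
    then obtain i j where "i < length ls" "j < ls ! i"
      "{u, v} = {theta_path_vertex ls i j, theta_path_vertex ls i (Suc j)}"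
      by (auto simp: generalized_theta_def)
    then show "P u v" using r assms by (auto simp: doubleton_eq_iff)
  qed
qed (simp add: theta_edge_in insert_commute)

text \<open>Every matching is completed to a bijection. It may have been partial before, so the
  edges of \<open>H\<close> are only contained in the graph of \<open>f i j\<close>.\<close>

lemma cover_theta_transitions:
  assumes "is_fold_cover m (generalized_theta ls) L H"
  obtains f where "bijective_transitions ls m L f"
    and "\<And>i j x y. i < length ls \<Longrightarrow> j < ls ! i \<Longrightarrow> x \<in> L (theta_path_vertex ls i j) \<Longrightarrow>
      y \<in> L (theta_path_vertex ls i (Suc j)) \<Longrightarrow> {x, y} \<in> edges H \<Longrightarrow> y = f i j x"
proof -
  let ?v = "theta_path_vertex ls"
  have fold: "\<And>v. v \<in> verts (generalized_theta ls) \<Longrightarrow> finite (L v) \<and> card (L v) = m"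
    and mat: "\<And>u v. u \<in> verts (generalized_theta ls) \<Longrightarrow> v \<in> verts (generalized_theta ls) \<Longrightarrow>
      {u, v} \<in> edges (generalized_theta ls) \<Longrightarrow> is_matching (edges_between H (L u) (L v))"
    using assms by (auto simp: is_fold_cover_def is_cover_def)
  have "\<exists>g. bij_betw g (L (?v i j)) (L (?v i (Suc j))) \<and>
      (\<forall>x \<in> L (?v i j). \<forall>y \<in> L (?v i (Suc j)). {x, y} \<in> edges H \<longrightarrow> y = g x)"
    if ij: "i < length ls" "j < ls ! i" for i j
  proof (rule partial_matching_extends_to_bijection)
    have v: "?v i j \<in> verts (generalized_theta ls)" "?v i (Suc j) \<in> verts (generalized_theta ls)"
      using ij by (auto intro!: theta_path_vertex_in)
    note M = mat[OF v theta_edge_in[OF ij]]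
    show "finite (L (?v i j))" "finite (L (?v i (Suc j)))" "card (L (?v i j)) = card (L (?v i (Suc j)))"
      using fold v by auto
    show "y = y'" if "x \<in> L (?v i j)" "y \<in> L (?v i (Suc j))" "y' \<in> L (?v i (Suc j))"
      "{x, y} \<in> edges H" "{x, y'} \<in> edges H" for x y y'
      using matching_unique[OF M that(1,2) that(1,3,4,5)] by (auto simp: doubleton_eq_iff)
    show "x = x'" if "x \<in> L (?v i j)" "x' \<in> L (?v i j)" "y \<in> L (?v i (Suc j))"
      "{x, y} \<in> edges H" "{x', y} \<in> edges H" for x x' y
      using matching_unique[OF M that(1,3) that(2,3,4,5)] by (auto simp: doubleton_eq_iff)
  qed
  then obtain f where f: "\<And>i j. i < length ls \<Longrightarrow> j < ls ! i \<Longrightarrow>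
      bij_betw (f i j) (L (?v i j)) (L (?v i (Suc j))) \<and>
      (\<forall>x \<in> L (?v i j). \<forall>y \<in> L (?v i (Suc j)). {x, y} \<in> edges H \<longrightarrow> y = f i j x)"
    by metis
  show thesis
    by (rule that[of f]) (use f fold in \<open>auto simp: bijective_transitions_def\<close>)
qed

lemma card_cover_colorings_theta:
  assumes cov: "is_cover (generalized_theta ls) L H" and pos: "\<forall>l \<in> set ls. 1 \<le> l"
  shows "card (cover_colorings (generalized_theta ls) H) =
    card {c \<in> PiE (verts (generalized_theta ls)) L. \<forall>i<length ls. \<forall>j<ls ! i.
      {c (theta_path_vertex ls i j), c (theta_path_vertex ls i (Suc j))} \<notin> edges H}"
proof -
  let ?G = "generalized_theta ls"
  have G: "simple_graph ?G" using pos by (rule simple_graph_generalized_theta)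
  then have "(\<forall>u \<in> verts ?G. \<forall>v \<in> verts ?G. {u, v} \<in> edges ?G \<longrightarrow> Q u v) \<longleftrightarrow>
      (\<forall>u v. {u, v} \<in> edges ?G \<longrightarrow> Q u v)" for Q
    by (auto simp: simple_graph_def)
  moreover have "finite (verts ?G)" using G by (simp add: simple_graph_def)
  ultimately show ?thesis
    using card_cover_colorings[OF cov] by (simp add: theta_edge_all_iff insert_commute)
qed

text \<open>Avoiding all pairs given by \<open>f\<close> implies avoiding all edges of
  \<open>H\<close>.\<close>

lemma cover_colorings_theta_ge:
  assumes cov: "is_fold_cover m (generalized_theta ls) L H" and pos: "\<forall>l \<in> set ls. 1 \<le> l"
    and f: "\<And>i j x y. i < length ls \<Longrightarrow> j < ls ! i \<Longrightarrow> x \<in> L (theta_path_vertex ls i j) \<Longrightarrow>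
      y \<in> L (theta_path_vertex ls i (Suc j)) \<Longrightarrow> {x, y} \<in> edges H \<Longrightarrow> y = f i j x"
  shows "card (theta_colorings ls L f) \<le> card (cover_colorings (generalized_theta ls) H)"
proof -
  let ?G = "generalized_theta ls"
  have "finite (PiE (verts ?G) L)"
    using cov simple_graph_generalized_theta[OF pos]
    by (intro finite_PiE) (auto simp: is_fold_cover_def simple_graph_def)
  moreover have "theta_colorings ls L f \<subseteq> {c \<in> PiE (verts ?G) L. \<forall>i<length ls. \<forall>j<ls ! i.
      {c (theta_path_vertex ls i j), c (theta_path_vertex ls i (Suc j))} \<notin> edges H}"
  proof
    fix c assume c: "c \<in> theta_colorings ls L f"
    have mem: "c (theta_path_vertex ls i j) \<in> L (theta_path_vertex ls i j)"
      if "i < length ls" "j \<le> ls ! i" for i j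
      using c theta_path_vertex_in[OF that] by (auto simp: theta_colorings_def)
    have "{c (theta_path_vertex ls i j), c (theta_path_vertex ls i (Suc j))} \<notin> edges H"
      if ij: "i < length ls" "j < ls ! i" for i j
      using f[OF ij mem mem] c ij by (auto simp: theta_colorings_def)
    then show "c \<in> {c \<in> PiE (verts ?G) L. \<forall>i<length ls. \<forall>j<ls ! i.
        {c (theta_path_vertex ls i j), c (theta_path_vertex ls i (Suc j))} \<notin> edges H}"
      using c by (simp add: theta_colorings_def)
  qed
  moreover have "is_cover ?G L H" using cov by (simp add: is_fold_cover_def)
  ultimately show ?thesis
    unfolding card_cover_colorings_theta[OF \<open>is_cover ?G L H\<close> pos] by (intro card_mono) auto
qed

lemma cover_colorings_theta_eq:
  assumes cov: "is_fold_cover m (generalized_theta ls) L H" and pos: "\<forall>l \<in> set ls. 1 \<le> l"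
    and f: "\<And>i j x y. i < length ls \<Longrightarrow> j < ls ! i \<Longrightarrow> x \<in> L (theta_path_vertex ls i j) \<Longrightarrow>
      y \<in> L (theta_path_vertex ls i (Suc j)) \<Longrightarrow> {x, y} \<in> edges H \<longleftrightarrow> y = f i j x"
  shows "card (cover_colorings (generalized_theta ls) H) = card (theta_colorings ls L f)"
proof -
  have "theta_colorings ls L f = {c \<in> PiE (verts (generalized_theta ls)) L. \<forall>i<length ls. \<forall>j<ls ! i.
      {c (theta_path_vertex ls i j), c (theta_path_vertex ls i (Suc j))} \<notin> edges H}"
    using f by (auto simp: theta_colorings_def PiE_iff theta_path_vertex_in)
  then show ?thesis
    using cov pos by (simp add: card_cover_colorings_theta is_fold_cover_def)
qed

section \<open>Exact counts for Theta graphs\<close>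

text \<open>Each path gives a factor with one indicator in the color \<open>b\<close> of
  \<open>End2\<close>. Summing over \<open>b\<close> leaves for every \<open>a\<close> an equal
  share of \<open>theta_base\<close> plus the gain of its transports.\<close>

lemma card_theta_colorings_3:
  assumes f: "bijective_transitions [l1, l2, l3] m S f" and pos: "0 < l1" "0 < l2" "0 < l3"
  shows "real (card (theta_colorings [l1, l2, l3] S f)) = theta_base m l1 l2 l3 +
    (\<Sum>a \<in> S End1. theta_gain m l1 l2 l3
      (transport (f 0) l1 a) (transport (f 1) l2 a) (transport (f 2) l3 a))"
proof -
  let ?ls = "[l1, l2, l3]"
  let ?S = "\<lambda>i j. S (theta_path_vertex ?ls i j)"
  have S: "finite (S v) \<and> card (S v) = m" if "v \<in> verts (generalized_theta ?ls)" for v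
    using f that by (simp add: bijective_transitions_def)
  have bij: "bij_betw (f i j) (?S i j) (?S i (Suc j))" if "i < length ?ls" "j < ?ls ! i" for i j
    using f that by (simp only: bijective_transitions_def)
  have len: "i < length ?ls \<Longrightarrow> 0 < ?ls ! i" for i
    using pos by (auto simp: less_Suc_eq)
  have ends: "?S i 0 = S End1" "?S i (?ls ! i) = S End2" if "i < length ?ls" for i
    using len[OF that] by (simp_all add: theta_path_vertex_last)
  have path: "real (card (path_colorings (?ls ! i) (?S i) (f i) a b)) =
      path_count m (?ls ! i) + (- 1) ^ (?ls ! i) * of_bool (b = transport (f i) (?ls ! i) a)"
    if "i < length ?ls" "a \<in> S End1" "b \<in> S End2" for i a b
    using that S bij ends[OF that(1)]
    by (intro card_path_colorings) (auto simp: theta_path_vertex_in)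
  have trans: "transport (f i) (?ls ! i) a \<in> S End2" if "i < length ?ls" "a \<in> S End1" for i a
    using transport_in[of "?ls ! i" "f i" "?S i" a] bij ends[OF that(1)] that by simp
  have S1: "finite (S End1)" "card (S End1) = m" and S2: "finite (S End2)" "card (S End2) = m"
    using S theta_ends_in by auto
  have "real (card (theta_colorings ?ls S f)) = (\<Sum>a \<in> S End1. \<Sum>b \<in> S End2. \<Prod>i<length ?ls.
      real (card (path_colorings (?ls ! i) (?S i) (f i) a b)))"
    by (subst card_theta_colorings) (use len S in auto)
  also have "\<dots> = (\<Sum>a \<in> S End1. \<Sum>b \<in> S End2. \<Prod>i<length ?ls.
      path_count m (?ls ! i) + (- 1) ^ (?ls ! i) * of_bool (b = transport (f i) (?ls ! i) a))"
    by (intro sum.cong prod.cong refl path) auto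
  also have "\<dots> = (\<Sum>a \<in> S End1. \<Sum>b \<in> S End2.
      (path_count m l1 + (- 1) ^ l1 * of_bool (b = transport (f 0) l1 a)) *
      (path_count m l2 + (- 1) ^ l2 * of_bool (b = transport (f 1) l2 a)) *
      (path_count m l3 + (- 1) ^ l3 * of_bool (b = transport (f 2) l3 a)))"
    by (simp add: numeral_2_eq_2 mult.assoc)
  also have "\<dots> = (\<Sum>a \<in> S End1. theta_base m l1 l2 l3 / real m + theta_gain m l1 l2 l3
      (transport (f 0) l1 a) (transport (f 1) l2 a) (transport (f 2) l3 a))"
  proof (rule sum.cong[OF refl])
    fix a assume a: "a \<in> S End1"
    then have "real m \<noteq> 0" using S1 card_gt_0_iff[of "S End1"] by auto
    then have "theta_base m l1 l2 l3 / real m =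
        real m * (path_count m l1 * path_count m l2 * path_count m l3)
        + (- 1) ^ l1 * path_count m l2 * path_count m l3
        + (- 1) ^ l2 * path_count m l1 * path_count m l3
        + (- 1) ^ l3 * path_count m l1 * path_count m l2"
      by (simp add: theta_base_def)
    then show "(\<Sum>b \<in> S End2.
      (path_count m l1 + (- 1) ^ l1 * of_bool (b = transport (f 0) l1 a)) *
      (path_count m l2 + (- 1) ^ l2 * of_bool (b = transport (f 1) l2 a)) *
      (path_count m l3 + (- 1) ^ l3 * of_bool (b = transport (f 2) l3 a))) =
      theta_base m l1 l2 l3 / real m + theta_gain m l1 l2 l3
        (transport (f 0) l1 a) (transport (f 1) l2 a) (transport (f 2) l3 a)"
      using trans[of 0 a] trans[of 1 a] trans[of 2 a] a
      by (subst sum_product_of_indicators[OF S2]) (simp_all add: theta_gain_def)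
  qed
  \<comment> \<open>If \<open>m = 0\<close> there is no \<open>a\<close>, and
    \<open>theta_base\<close> vanishes through its outer factor, so the division by
    \<open>real m\<close> does no harm.\<close>
  also have "\<dots> = theta_base m l1 l2 l3 + (\<Sum>a \<in> S End1. theta_gain m l1 l2 l3
      (transport (f 0) l1 a) (transport (f 1) l2 a) (transport (f 2) l3 a))"
    using S1 by (cases "m = 0") (simp_all add: sum.distrib theta_base_def)
  finally show ?thesis .
qed

text \<open>Proper colorings are the case of identity transitions, where the three transports of
  every color agree; \<open>()\<close> stands for the common value.\<close>

lemma chromatic_polynomial_theta:
  assumes "0 < l1" "0 < l2" "0 < l3"
  shows "real (chromatic_polynomial (generalized_theta [l1, l2, l3]) m) =
    theta_base m l1 l2 l3 + real m * theta_gain m l1 l2 l3 () () ()"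
proof -
  let ?f = "\<lambda>i j x. x" and ?S = "\<lambda>_. {1..m}"
  have "chromatic_polynomial (generalized_theta [l1, l2, l3]) m =
      card (theta_colorings [l1, l2, l3] ?S ?f)"
  proof -
    have "(\<forall>u v. {u, v} \<in> edges (generalized_theta [l1, l2, l3]) \<longrightarrow> c u \<noteq> c v) \<longleftrightarrow>
        (\<forall>i<length [l1, l2, l3]. \<forall>j<[l1, l2, l3] ! i.
          c (theta_path_vertex [l1, l2, l3] i (Suc j)) \<noteq> c (theta_path_vertex [l1, l2, l3] i j))"
      for c :: "theta_vertex \<Rightarrow> nat"
      by (rule theta_edge_all_iff) auto
    then show ?thesis
      by (simp only: chromatic_polynomial_def theta_colorings_def)
  qed
  moreover have "bijective_transitions [l1, l2, l3] m ?S ?f"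
    by (auto simp: bijective_transitions_def bij_betw_def inj_on_def)
  moreover have "transport (\<lambda>j x. x) l a = a" for l and a :: nat
    by (induction l) auto
  ultimately show ?thesis
    using assms by (simp add: card_theta_colorings_3 theta_gain_def)
qed

text \<open>The shift \<open>k i\<close> sits on the first edge of path \<open>i\<close> and all
  other matchings are identities. Transport along path \<open>i\<close> thus adds \<open>k i\<close>
  modulo \<open>m\<close>, with the same coincidences for every starting color.\<close>

lemma shift_cover_theta:
  fixes k :: "nat \<Rightarrow> nat"
  assumes len: "2 \<le> l1" "2 \<le> l2" "2 \<le> l3" and k: "\<And>i. k i \<le> m - 1"
  obtains L and H :: "(theta_vertex \<times> nat) graph"
  where "is_fold_cover m (generalized_theta [l1, l2, l3]) L H"
    and "real (card (cover_colorings (generalized_theta [l1, l2, l3]) H)) =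
      theta_base m l1 l2 l3 + real m * theta_gain m l1 l2 l3 (k 0) (k 1) (k 2)"
proof -
  define ls where "ls = [l1, l2, l3]"
  define G where "G = generalized_theta ls"
  \<comment> \<open>Since every path has length at least 2, the neighbor of \<open>End1\<close> on
    path \<open>i\<close> is an \<open>Inner\<close> vertex, from which the path index can be read
    off.\<close>
  define t where "t = (\<lambda>u v. case v of Inner i j \<Rightarrow> if u = End1 then k i else 0 | _ \<Rightarrow> 0)"
  define H where "H = shift_cover G m t"
  define L where "L = (\<lambda>u :: theta_vertex. {u} \<times> {..<m})"
  define f where "f = (\<lambda>i j p :: theta_vertex \<times> nat.
    (theta_path_vertex ls i (Suc j), (snd p + (if j = 0 then k i else 0)) mod m))"
  have pos: "\<forall>l \<in> set ls. 1 \<le> l" using len by (auto simp: ls_def)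
  have two: "2 \<le> ls ! i" if "i < length ls" for i
    using len that by (auto simp: ls_def less_Suc_eq)
  have cov: "is_fold_cover m G L H"
    unfolding H_def L_def G_def by (intro is_fold_cover_shift_cover simple_graph_generalized_theta pos)
  have edge: "{x, y} \<in> edges H \<longleftrightarrow> y = f i j x"
    if ij: "i < length ls" "j < ls ! i"
      and x: "x \<in> L (theta_path_vertex ls i j)" and y: "y \<in> L (theta_path_vertex ls i (Suc j))" for i j x y
  proof -
    let ?u = "theta_path_vertex ls i j" and ?v = "theta_path_vertex ls i (Suc j)"
    have "?u \<noteq> ?v" using ij by (auto simp: theta_path_vertex_def)
    moreover have "{?u, ?v} \<in> edges G" unfolding G_def using ij by (rule theta_edge_in)
    moreover have t: "t ?u ?v = (if j = 0 then k i else 0)" "t ?v ?u = 0"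
      using ij two[OF ij(1)] by (simp_all add: t_def theta_path_vertex_def)
    moreover obtain a b where xy: "x = (?u, a)" "y = (?v, b)" and ab: "a < m" "b < m"
      using x y by (auto simp: L_def)
    ultimately have "{x, y} \<in> edges H \<longleftrightarrow> (a + (if j = 0 then k i else 0)) mod m = b"
      by (simp add: xy H_def shift_cover_edge_iff)
    then show ?thesis
      unfolding xy by (simp add: f_def eq_commute[of b])
  qed
  have "bijective_transitions ls m L f"
    unfolding bijective_transitions_def
  proof (intro conjI ballI allI impI)
    fix v show "finite (L v)" "card (L v) = m" by (auto simp: L_def card_cartesian_product)
  next
    fix i j assume "i < length ls" "j < ls ! i"
    have "inj_on (f i j) (L (theta_path_vertex ls i j))"
      by (intro inj_onI) (auto simp: L_def f_def mod_add_cancel_right_nat)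
    moreover have "f i j ` L (theta_path_vertex ls i j) \<subseteq> L (theta_path_vertex ls i (Suc j))"
      by (auto simp: L_def f_def)
    moreover have "finite (L v)" "card (L v) = m" for v by (auto simp: L_def card_cartesian_product)
    ultimately show "bij_betw (f i j) (L (theta_path_vertex ls i j)) (L (theta_path_vertex ls i (Suc j)))"
      unfolding bij_betw_def by (metis card_image card_subset_eq)
  qed
  then have "real (card (theta_colorings ls L f)) = theta_base m l1 l2 l3 +
    (\<Sum>a \<in> L End1. theta_gain m l1 l2 l3
      (transport (f 0) l1 a) (transport (f 1) l2 a) (transport (f 2) l3 a))"
    unfolding ls_def using len by (intro card_theta_colorings_3) auto
  also have "(\<Sum>a \<in> L End1. theta_gain m l1 l2 l3
      (transport (f 0) l1 a) (transport (f 1) l2 a) (transport (f 2) l3 a)) =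
      (\<Sum>a \<in> L End1. theta_gain m l1 l2 l3 (k 0) (k 1) (k 2))"
  proof (rule sum.cong[OF refl])
    fix a assume "a \<in> L End1"
    then obtain x where a: "a = (End1, x)" and x: "x < m" by (auto simp: L_def)
    have tr: "transport (f i) j a = (theta_path_vertex ls i j, (x + (if j = 0 then 0 else k i)) mod m)" for i j
      by (induction j) (auto simp: f_def a x mod_simps)
    have last: "theta_path_vertex ls 0 l1 = End2" "theta_path_vertex ls 1 l2 = End2"
      "theta_path_vertex ls 2 l3 = End2"
      using len by (simp_all add: theta_path_vertex_def ls_def)
    \<comment> \<open>\<open>x < m\<close> forces \<open>m > 0\<close>, so
      \<open>k i \<le> m - 1\<close> means \<open>k i < m\<close> and shifts equal modulo
      \<open>m\<close> are equal.\<close>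
    have "(x + k i) mod m = (x + k j) mod m \<longleftrightarrow> k i = k j" for i j
      using mod_add_cancel_right_nat[of "k i" m "k j" x] k[of i] k[of j] x by (simp add: add.commute)
    then show "theta_gain m l1 l2 l3 (transport (f 0) l1 a) (transport (f 1) l2 a) (transport (f 2) l3 a) =
        theta_gain m l1 l2 l3 (k 0) (k 1) (k 2)"
      using len by (simp add: theta_gain_def tr last del: One_nat_def)
  qed
  finally have "real (card (theta_colorings ls L f)) =
      theta_base m l1 l2 l3 + real m * theta_gain m l1 l2 l3 (k 0) (k 1) (k 2)"
    by (simp add: L_def card_cartesian_product)
  moreover have "card (cover_colorings G H) = card (theta_colorings ls L f)"
    unfolding G_def using cov pos edge by (intro cover_colorings_theta_eq) (auto simp: G_def)
  ultimately show thesis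
    using that cov by (simp add: G_def ls_def)
qed

section \<open>The minimum over all covers\<close>

text \<open>Completing the matchings does not raise the count, and afterwards each of the
  \<open>m\<close> colors of \<open>End1\<close> gains at least \<open>\<mu>\<close>.\<close>

lemma theta_cover_lower_bound:
  assumes cov: "is_fold_cover m (generalized_theta [l1, l2, l3]) (L :: theta_vertex \<Rightarrow> 'b set) H"
    and pos: "0 < l1" "0 < l2" "0 < l3"
    and gain: "\<And>b1 b2 b3 :: 'b. \<mu> \<le> theta_gain m l1 l2 l3 b1 b2 b3"
  shows "theta_base m l1 l2 l3 + real m * \<mu> \<le>
    real (card (cover_colorings (generalized_theta [l1, l2, l3]) H))"
proof -
  have ls: "\<forall>l \<in> set [l1, l2, l3]. 1 \<le> l" using pos by auto
  obtain f where f: "bijective_transitions [l1, l2, l3] m L f"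
    and ge: "card (theta_colorings [l1, l2, l3] L f) \<le>
      card (cover_colorings (generalized_theta [l1, l2, l3]) H)"
    by (rule cover_theta_transitions[OF cov]) (use cover_colorings_theta_ge[OF cov ls] in blast)
  have m: "card (L End1) = m"
    using cov theta_ends_in(1) by (auto simp: is_fold_cover_def)
  have "real (card (L End1)) * \<mu> \<le> (\<Sum>a \<in> L End1. theta_gain m l1 l2 l3
      (transport (f 0) l1 a) (transport (f 1) l2 a) (transport (f 2) l3 a))"
    by (rule sum_bounded_below) (rule gain)
  then show ?thesis
    unfolding m using card_theta_colorings_3[OF f pos] ge by linarith
qed

text \<open>Shifts whose coincidences minimize the gain attain the lower bound. Minimality over
  \<open>nat\<close> suffices because the competing covers have natural numbers as vertices.\<close>

lemma dp_color_function_theta: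
  assumes len: "2 \<le> l1" "2 \<le> l2" "2 \<le> l3" and k: "k1 \<le> m - 1" "k2 \<le> m - 1" "k3 \<le> m - 1"
    and gain: "\<And>b1 b2 b3 :: nat. theta_gain m l1 l2 l3 k1 k2 k3 \<le> theta_gain m l1 l2 l3 b1 b2 b3"
  shows "real (dp_color_function (generalized_theta [l1, l2, l3]) m) =
    theta_base m l1 l2 l3 + real m * theta_gain m l1 l2 l3 k1 k2 (k3 :: nat)"
proof -
  let ?k = "\<lambda>i :: nat. if i = 0 then k1 else if i = 1 then k2 else k3"
  obtain L and H :: "(theta_vertex \<times> nat) graph"
    where cov: "is_fold_cover m (generalized_theta [l1, l2, l3]) L H"
    and count: "real (card (cover_colorings (generalized_theta [l1, l2, l3]) H)) =
      theta_base m l1 l2 l3 + real m * theta_gain m l1 l2 l3 (?k 0) (?k 1) (?k 2)"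
    proof (rule shift_cover_theta[OF len])
    show "?k i \<le> m - 1" for i using k by simp
  qed
  have "dp_color_function (generalized_theta [l1, l2, l3]) m =
      card (cover_colorings (generalized_theta [l1, l2, l3]) H)"
  proof (rule dp_color_function_eqI[OF cov])
    fix L' and H' :: "nat graph"
    assume "is_fold_cover m (generalized_theta [l1, l2, l3]) L' H'"
    from theta_cover_lower_bound[OF this _ _ _ gain] len count
    show "card (cover_colorings (generalized_theta [l1, l2, l3]) H) \<le>
        card (cover_colorings (generalized_theta [l1, l2, l3]) H')" by simp
  qed
  then show ?thesis using count by simp
qed

section \<open>The four parity cases\<close>

theorem theorem1p3:
  fixes l1 l2 l3 :: nat and G :: "theta_vertex graph"
  assumes "2 \<le> l1" and "l1 \<le> l2" and "l2 \<le> l3"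
    and "G = generalized_theta [l1, l2, l3]"
  shows "(even l1 \<noteq> even l2 \<and> even l1 \<noteq> even l3 \<longrightarrow>
            (\<forall>m. dp_color_function G m = chromatic_polynomial G m)) \<and>
         (even l1 = even l2 \<and> even l3 \<noteq> even l1 \<longrightarrow>
            (\<forall>m \<ge> 2. real (dp_color_function G m) =
               1 / real m * ((real m - 1) ^ (l1 + l2 + l3) + (real m - 1) ^ l1
                 - (real m - 1) ^ (l2 + 1) - (real m - 1) ^ l3
                 + (- 1) ^ (l3 + 1) * (real m - 2)))) \<and>
         (even l1 = even l3 \<and> even l2 \<noteq> even l1 \<longrightarrow>
            (\<forall>m \<ge> 2. real (dp_color_function G m) =
               1 / real m * ((real m - 1) ^ (l1 + l2 + l3) + (real m - 1) ^ l1
                 - (real m - 1) ^ (l3 + 1) - (real m - 1) ^ l2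
                 + (- 1) ^ (l2 + 1) * (real m - 2)))) \<and>
         (even l1 = even l2 \<and> even l2 = even l3 \<longrightarrow>
            (\<forall>m \<ge> 3. real (dp_color_function G m) =
               1 / real m * ((real m - 1) ^ (l1 + l2 + l3) - (real m - 1) ^ l1
                 - (real m - 1) ^ l2 - (real m - 1) ^ l3
                 + 2 * (- 1) ^ (l1 + l2 + l3))))"
proof -
  have len: "2 \<le> l1" "2 \<le> l2" "2 \<le> l3" and pos: "0 < l1" "0 < l2" "0 < l3"
    using assms by auto
  note dp = dp_color_function_theta[OF len, folded assms(4)]
  have chrom: "dp_color_function G m = chromatic_polynomial G m"
    if par: "even l1 \<noteq> even l2" "even l1 \<noteq> even l3" for m
  proof (cases "2 \<le> m")
    case True
    \<comment> \<open>Full agreement gains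
      \<open>B\<^sub>1 - B\<^sub>2 - B\<^sub>3 + (- 1) ^ l1\<close>; the single coincidences gain
      \<open>- B\<^sub>3\<close>, \<open>- B\<^sub>2\<close> and \<open>B\<^sub>1\<close>. As
      \<open>B\<^sub>1 + (- 1) ^ l1\<close> is at most \<open>B\<^sub>2\<close> and
      \<open>B\<^sub>3\<close>, full agreement is best.\<close>
    have "l1 < l2" "l1 < l3" using par assms by (auto simp: order_le_less)
    then have "real (dp_color_function G m) =
        theta_base m l1 l2 l3 + real m * theta_gain m l1 l2 l3 0 0 (0 :: nat)"
      using par path_count_plus_sign_le[OF True, of l1 l2] path_count_plus_sign_le[OF True, of l1 l3]
        path_count_nonneg[OF True, of l1] path_count_nonneg[OF True, of l2]
        path_count_nonneg[OF True, of l3]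
      by (intro dp) (auto simp: theta_gain_def uminus_power_if)
    then show ?thesis
      using chromatic_polynomial_theta[OF pos, of m] by (simp add: assms(4) theta_gain_def)
  next
    case False
    \<comment> \<open>The path inequalities need \<open>m \<ge> 2\<close>. For smaller
      \<open>m\<close> the unshifted cover has no coloring at all, so it is trivially
      minimal.\<close>
    then have "real (chromatic_polynomial G m) = 0"
      using chromatic_polynomial_theta[OF pos, of m] pos par
      by (cases "m = 0") (auto simp: assms(4) theta_gain_def theta_base_def path_count_def
          uminus_power_if less_2_cases_iff not_le power_0_left)
    moreover obtain L and H :: "(theta_vertex \<times> nat) graph" where
      cov: "is_fold_cover m G L H" and "real (card (cover_colorings G H)) =
        theta_base m l1 l2 l3 + real m * theta_gain m l1 l2 l3 0 0 (0 :: nat)"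
      unfolding assms(4) by (rule shift_cover_theta[OF len, of "\<lambda>_. 0" m]) auto
    ultimately have "card (cover_colorings G H) = chromatic_polynomial G m"
      "chromatic_polynomial G m = 0"
      using chromatic_polynomial_theta[OF pos, of m] by (simp_all add: assms(4) theta_gain_def)
    then show ?thesis using dp_color_function_eqI[OF cov] by simp
  qed
  have ii: "real (dp_color_function G m) =
      1 / real m * ((real m - 1) ^ (l1 + l2 + l3) + (real m - 1) ^ l1
      - (real m - 1) ^ (l2 + 1) - (real m - 1) ^ l3 + (- 1) ^ (l3 + 1) * (real m - 2))"
    if par: "even l1 = even l2" "even l3 \<noteq> even l1" and m: "2 \<le> m" for m
  proof -
    \<comment> \<open>The shifts \<open>0 1 0\<close> make only paths 1 and 3 agree, with gain
      \<open>- B\<^sub>2\<close>. This beats \<open>- B\<^sub>1\<close> by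
      \<open>path_count_mono\<close>, and full agreement because
      \<open>B\<^sub>1 \<le> B\<^sub>3 + (- 1) ^ l3\<close>.\<close>
    have "l1 < l3" using par assms by (auto simp: order_le_less)
    then have val: "real (dp_color_function G m) =
        theta_base m l1 l2 l3 + real m * theta_gain m l1 l2 l3 0 1 (0 :: nat)"
      using par m assms path_count_le_plus_sign[OF m, of l1 l3] path_count_mono[OF m, of l1 l2]
        path_count_nonneg[OF m, of l1] path_count_nonneg[OF m, of l2]
        path_count_nonneg[OF m, of l3]
      by (intro dp) (auto simp: theta_gain_def uminus_power_if)
    show ?thesis
      unfolding val using par m
      by (auto simp: theta_base_def theta_gain_def path_count_def uminus_power_if power_add field_simps)
  qed
  have iii: "real (dp_color_function G m) =
      1 / real m * ((real m - 1) ^ (l1 + l2 + l3) + (real m - 1) ^ l1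
      - (real m - 1) ^ (l3 + 1) - (real m - 1) ^ l2 + (- 1) ^ (l2 + 1) * (real m - 2))"
    if par: "even l1 = even l3" "even l2 \<noteq> even l1" and m: "2 \<le> m" for m
  proof -
    \<comment> \<open>The same argument with paths 2 and 3 exchanged: only paths 1 and 2 agree, with
      gain \<open>- B\<^sub>3\<close>.\<close>
    have "l1 < l2" using par assms by (auto simp: order_le_less)
    then have val: "real (dp_color_function G m) =
        theta_base m l1 l2 l3 + real m * theta_gain m l1 l2 l3 0 0 (1 :: nat)"
      using par m assms path_count_le_plus_sign[OF m, of l1 l2] path_count_mono[OF m, of l1 l3]
        path_count_nonneg[OF m, of l1] path_count_nonneg[OF m, of l2]
        path_count_nonneg[OF m, of l3]
      by (intro dp) (auto simp: theta_gain_def uminus_power_if)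
    show ?thesis
      unfolding val using par m
      by (auto simp: theta_base_def theta_gain_def path_count_def uminus_power_if power_add field_simps)
  qed
  have iv: "real (dp_color_function G m) =
      1 / real m * ((real m - 1) ^ (l1 + l2 + l3) - (real m - 1) ^ l1
      - (real m - 1) ^ l2 - (real m - 1) ^ l3 + 2 * (- 1) ^ (l1 + l2 + l3))"
    if par: "even l1 = even l2" "even l2 = even l3" and m: "3 \<le> m" for m
  proof -
    have m2: "2 \<le> m" using m by simp
    \<comment> \<open>Every coincidence now has nonnegative gain, so three distinct transports are
      best, with gain 0. The shifts \<open>0 1 2\<close> require three colors.\<close>
    have val: "real (dp_color_function G m) =
        theta_base m l1 l2 l3 + real m * theta_gain m l1 l2 l3 0 1 (2 :: nat)"
      using par m path_count_plus_sign_nonneg[OF m2 pos(1)]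
        path_count_nonneg[OF m2, of l1] path_count_nonneg[OF m2, of l2]
        path_count_nonneg[OF m2, of l3]
      by (intro dp) (auto simp: theta_gain_def uminus_power_if)
    show ?thesis
      unfolding val using par m
      by (auto simp: theta_base_def theta_gain_def path_count_def uminus_power_if power_add field_simps)
  qed
  show ?thesis using chrom ii iii iv by blast
qed

end
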